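(* For every $d\ge1$, there are at most $(d!)^{d+1}\,2^{3^d\,d!}$ distinct $\mathrm{GL}_d(\mathbb Z)$-orbits of $d$-dimensional symmetric lattice polytopes $P\subset\mathbb R^d$ whose interior contains no nonzero element of $\mathbb Z^d$.
   Context: A lattice polytope is the convex hull of finitely many points of $\mathbb Z^d$; it is $d$-dimensional if it has nonempty interior; it is symmetric if $P=-P$. $\mathrm{GL}_d(\mathbb Z)$ acts linearly on $\mathbb R^d$ and hence on such polytopes. *)

theory Defs
  imports "HOL-Analysis.Analysis"
begin

definition lattice_points :: "(real ^ 'n) set" where
  "lattice_points = {x. \<forall>i. x $ i \<in> \<int>}"

definition lattice_polytope :: "(real ^ 'n) set \<Rightarrow> bool" where
  "lattice_polytope P \<longleftrightarrow> (\<exists>S. finite S \<and> S \<subseteq> lattice_points \<and> P = convex hull S)"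

definition GL_Z :: "(real ^ 'n ^ 'n) set" where
  "GL_Z = {A. (\<forall>i j. A $ i $ j \<in> \<int>) \<and> invertible A \<and> (\<forall>i j. matrix_inv A $ i $ j \<in> \<int>)}"

definition GL_Z_equiv :: "(real ^ 'n) set \<Rightarrow> (real ^ 'n) set \<Rightarrow> bool" where
  "GL_Z_equiv P Q \<longleftrightarrow> (\<exists>A \<in> GL_Z. Q = (\<lambda>x. A *v x) ` P)"

definition sym_lp_no_int :: "(real ^ 'n) set set" where
  "sym_lp_no_int = {P. lattice_polytope P \<and> interior P \<noteq> {} \<and> uminus ` P = P
                       \<and> (\<forall>x \<in> interior P \<inter> lattice_points. x = 0)}"

definition sym_lp_orbits :: "(real ^ 'n) set set set" where
  "sym_lp_orbits = {{Q \<in> sym_lp_no_int. GL_Z_equiv P Q} | P. P \<in> sym_lp_no_int}"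

end

theory Submission
  imports Defs
begin

text \<open>
  Choose lattice vectors in \<open>P\<close> whose matrix \<open>V\<close> has maximal determinant. In the coordinates given
  by \<open>V\<close>, the lattice becomes some \<open>L \<supseteq> \<int>\<^sup>d\<close>, the points of \<open>P \<inter> \<int>\<^sup>d\<close> lie in \<open>[-1,1]\<^sup>d\<close>, and the open
  cross-polytope contains no nonzero point of \<open>L\<close>. Hence the translates of half the cross-polytope by
  \<open>L\<close> are disjoint, and comparing volumes modulo \<open>\<int>\<^sup>d\<close> gives \<open>[L : \<int>\<^sup>d] \<le> d!\<close>. The orbit of \<open>P\<close> is determined
  by \<open>L\<close> and the subset of \<open>L \<inter> [-1,1]\<^sup>d\<close> corresponding to \<open>P \<inter> \<int>\<^sup>d\<close>; the set \<open>L \<inter> [-1,1]\<^sup>d\<close> has at most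
  \<open>3\<^sup>d d!\<close> elements. There are at most \<open>M\<^bsup>d+1\<^esup>\<close> lattices \<open>L\<close> of index at most \<open>M\<close>: splitting off one
  coordinate, \<open>L\<close> is given by its kernel \<open>K\<close> of index at most \<open>M/b\<close> and one of \<open>b\<^bsup>d-1\<^esup>\<close> cosets, and
  each \<open>b \<le> M\<close> contributes at most \<open>b\<^bsup>d-1\<^esup> (M/b)\<^sup>d \<le> M\<^sup>d\<close>.
\<close>

subsection \<open>Lattices containing the integer lattice\<close>

text \<open>Half-open, so that every class modulo \<open>lattice_points\<close> has exactly one
  representative in it.\<close>

definition unit_cell :: "(real ^ 'n) set" where
  "unit_cell = {x. \<forall>j. 0 \<le> x $ j \<and> x $ j < 1}"

text \<open>Lattices in the coordinate subspace indexed by \<open>I\<close> that contain its integer points. The index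
  over the integer points is the number of points in the unit cell.\<close>

definition superlattice :: "'n set \<Rightarrow> (real ^ 'n) set \<Rightarrow> bool" where
  "superlattice I L \<longleftrightarrow>
     (\<forall>x\<in>L. \<forall>j. j \<notin> I \<longrightarrow> x $ j = 0) \<and> (\<forall>x\<in>L. \<forall>y\<in>L. x - y \<in> L) \<and>
     (\<forall>x\<in>lattice_points. (\<forall>j. j \<notin> I \<longrightarrow> x $ j = 0) \<longrightarrow> x \<in> L)"

definition vec_frac :: "real ^ 'n \<Rightarrow> real ^ 'n" where
  "vec_frac x = (\<chi> j. frac (x $ j))"

lemma vec_frac_nth [simp]: "vec_frac x $ j = frac (x $ j)"
  by (simp add: vec_frac_def)

lemma vec_frac_in_unit_cell [simp]: "vec_frac x \<in> unit_cell"
  by (simp add: unit_cell_def frac_lt_1)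

lemma diff_vec_frac_lattice: "x - vec_frac x \<in> lattice_points"
  by (simp add: lattice_points_def frac_def)

lemma vec_frac_eq_iff: "vec_frac x = vec_frac y \<longleftrightarrow> x - y \<in> lattice_points"
proof -
  have "frac a = frac b \<longleftrightarrow> a - b \<in> \<int>" for a b :: real
  proof
    assume "frac a = frac b"
    then have "a - b = of_int (\<lfloor>a\<rfloor> - \<lfloor>b\<rfloor>)" by (simp add: frac_def algebra_simps)
    then show "a - b \<in> \<int>" by (metis Ints_of_int)
  next
    assume "a - b \<in> \<int>"
    then obtain k where "a = b + of_int k" by (metis Ints_cases add.commute diff_add_cancel)
    then show "frac a = frac b" by (simp add: frac_def)
  qed
  then show ?thesis by (simp add: vec_eq_iff lattice_points_def)
qed

lemma vec_frac_unit_cell: "x \<in> unit_cell \<Longrightarrow> vec_frac x = x"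
  by (simp add: unit_cell_def vec_eq_iff frac_eq)

lemma unit_cell_eqI:
  assumes "x \<in> unit_cell" "y \<in> unit_cell" "x - y \<in> lattice_points"
  shows "x = y"
  using assms vec_frac_eq_iff[of x y] by (simp add: vec_frac_unit_cell)

lemma zero_in_unit_cell [simp]: "0 \<in> unit_cell"
  by (simp add: unit_cell_def)

context
  fixes I :: "'n::finite set" and L :: "(real ^ 'n) set"
  assumes L: "superlattice I L"
begin

lemma superlattice_supp: "x \<in> L \<Longrightarrow> j \<notin> I \<Longrightarrow> x $ j = 0"
  using L by (simp add: superlattice_def)

lemma superlattice_diff: "x \<in> L \<Longrightarrow> y \<in> L \<Longrightarrow> x - y \<in> L"
  using L by (simp add: superlattice_def)

lemma superlattice_lattice: "x \<in> lattice_points \<Longrightarrow> (\<And>j. j \<notin> I \<Longrightarrow> x $ j = 0) \<Longrightarrow> x \<in> L"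
  using L by (simp add: superlattice_def)

lemma superlattice_zero: "0 \<in> L"
  by (rule superlattice_lattice) (simp_all add: lattice_points_def)

lemma superlattice_add: "x \<in> L \<Longrightarrow> y \<in> L \<Longrightarrow> x + y \<in> L"
  using superlattice_diff[of x "0 - y"] superlattice_diff[of 0 y] superlattice_zero by simp

lemma superlattice_scale: "x \<in> L \<Longrightarrow> of_int m *\<^sub>R x \<in> L"
proof -
  assume x: "x \<in> L"
  have nat: "of_nat k *\<^sub>R x \<in> L" for k
    by (induction k) (simp_all add: superlattice_zero superlattice_add x scaleR_add_left)
  show ?thesis
  proof (cases "m \<ge> 0")
    case True
    then show ?thesis using nat[of "nat m"] by simp
  next
    case False
    then show ?thesis using superlattice_diff[OF superlattice_zero nat[of "nat (- m)"]] by simp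
  qed
qed

lemma superlattice_vec_frac: "x \<in> L \<Longrightarrow> vec_frac x \<in> L"
proof -
  assume x: "x \<in> L"
  have "x - vec_frac x \<in> L"
    by (rule superlattice_lattice[OF diff_vec_frac_lattice]) (simp add: superlattice_supp x)
  from superlattice_diff[OF x this] show ?thesis by simp
qed

end

section \<open>Counting lattices of bounded index by splitting off one coordinate\<close>

text \<open>If \<open>L\<close> extends \<open>K\<close> by one coordinate, with values in \<open>(1/b)\<int>\<close>, the vectors \<open>k0\<close> such that
  \<open>k0 + e/b \<in> L\<close> form one coset of \<open>K\<close> in \<open>(1/b) K\<close>; cosets are recorded by their points in the
  unit cell.\<close>

definition lift_cosets :: "nat \<Rightarrow> 'n set \<Rightarrow> (real ^ 'n) set \<Rightarrow> (real ^ 'n) set set" where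
  "lift_cosets b I K = {{k \<in> unit_cell. k - k0 \<in> K} | k0.
      real b *\<^sub>R k0 \<in> K \<and> (\<forall>j. j \<notin> I \<longrightarrow> k0 $ j = 0)}"

text \<open>The cosets divide up points of (1/b)K in the unit cell. Such a point \<open>k\<close> is
  determined by \<open>b k\<close> modulo integers, one of \<open>n\<close> points, and by the
  integer parts of the coordinates of \<open>b k\<close>, each below \<open>b\<close>; so there are
  at most \<open>n * b ^ card I\<close> of them. Each coset takes exactly \<open>n\<close>.\<close>

lemma card_lift_cosets:
  fixes K :: "(real ^ 'n) set"
  assumes K: "superlattice I K" and fin: "finite (K \<inter> unit_cell)" and b: "b > 0"
  shows "finite (lift_cosets b I K) \<and> card (lift_cosets b I K) \<le> b ^ card I"
proof -
  define n where "n = card (K \<inter> unit_cell)"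
  have npos: "n > 0"
    unfolding n_def using fin superlattice_zero[OF K] by (auto simp: card_gt_0_iff)
  define U where "U = {k \<in> unit_cell. real b *\<^sub>R k \<in> K \<and> (\<forall>j. j \<notin> I \<longrightarrow> k $ j = 0)}"
  define f where "f = (\<lambda>k::real^'n. (vec_frac (real b *\<^sub>R k), restrict (\<lambda>j. nat \<lfloor>real b * k $ j\<rfloor>) I))"
  have inj: "inj_on f U"
  proof (rule inj_onI)
    fix x y assume x: "x \<in> U" and y: "y \<in> U" and e: "f x = f y"
    have "x $ j = y $ j" for j
    proof (cases "j \<in> I")
      case True
      have "frac (real b * x $ j) = frac (real b * y $ j)"
        using e by (auto simp: f_def vec_eq_iff)
      moreover have nat_eq: "nat \<lfloor>real b * x $ j\<rfloor> = nat \<lfloor>real b * y $ j\<rfloor>"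
        using e True by (auto simp: f_def restrict_def dest: fun_cong[of _ _ j])
      moreover have "real b * x $ j \<ge> 0" "real b * y $ j \<ge> 0"
        using x y by (auto simp: U_def unit_cell_def)
      moreover from this nat_eq have "\<lfloor>real b * x $ j\<rfloor> = \<lfloor>real b * y $ j\<rfloor>"
        by (metis nat_0_le zero_le_floor)
      ultimately have "real b * x $ j = real b * y $ j"
        by (simp add: frac_def)
      then show ?thesis using b by simp
    next
      case False
      then show ?thesis using x y by (simp add: U_def)
    qed
    then show "x = y" by (simp add: vec_eq_iff)
  qed
  have im: "f ` U \<subseteq> (K \<inter> unit_cell) \<times> (I \<rightarrow>\<^sub>E {..<b})"
  proof
    fix p assume "p \<in> f ` U"
    then obtain k where k: "k \<in> U" "p = f k" by auto
    have "vec_frac (real b *\<^sub>R k) \<in> K"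
      using k(1) by (intro superlattice_vec_frac[OF K]) (simp add: U_def)
    moreover have "nat \<lfloor>real b * k $ j\<rfloor> < b" for j
    proof -
      have "real b * k $ j < real b" "real b * k $ j \<ge> 0" using k(1) b by (auto simp: U_def unit_cell_def)
      then show ?thesis by (metis floor_less_iff nat_less_iff of_int_of_nat_eq zero_le_floor)
    qed
    ultimately show "p \<in> (K \<inter> unit_cell) \<times> (I \<rightarrow>\<^sub>E {..<b})"
      by (simp add: k(2) f_def)
  qed
  have finim: "finite ((K \<inter> unit_cell) \<times> (I \<rightarrow>\<^sub>E {..<b}))"
    using fin by (simp add: finite_PiE)
  have finU: "finite U" using inj_on_finite[OF inj im finim] .
  have "card U \<le> card ((K \<inter> unit_cell) \<times> (I \<rightarrow>\<^sub>E {..<b}))"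
    using card_inj_on_le[OF inj im finim] .
  then have cardU: "card U \<le> n * b ^ card I"
    by (simp add: card_cartesian_product card_PiE n_def)
  have sub: "\<Union>(lift_cosets b I K) \<subseteq> U"
  proof
    fix k assume "k \<in> \<Union>(lift_cosets b I K)"
    then obtain k0 where k: "k \<in> unit_cell" "k - k0 \<in> K" "real b *\<^sub>R k0 \<in> K" "\<And>j. j \<notin> I \<Longrightarrow> k0 $ j = 0"
      by (auto simp: lift_cosets_def)
    have "real b *\<^sub>R (k - k0) \<in> K" using superlattice_scale[OF K k(2), of "int b"] by simp
    from superlattice_add[OF K this k(3)] have "real b *\<^sub>R k \<in> K" by (simp add: algebra_simps)
    moreover have "k $ j = 0" if "j \<notin> I" for j
      using superlattice_supp[OF K k(2) that] k(4)[OF that] by simp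
    ultimately show "k \<in> U" using k(1) by (simp add: U_def)
  qed
  have card_eq: "card C = n" if "C \<in> lift_cosets b I K" for C
  proof -
    from that obtain k0 where C: "C = {k \<in> unit_cell. k - k0 \<in> K}"
      and s: "\<And>j. j \<notin> I \<Longrightarrow> k0 $ j = 0"
      unfolding lift_cosets_def by blast
    \<comment> \<open>Translation by \<open>k0\<close> carries \<open>K\<close> to its coset, and
      reduction brings the result back into the cell; both respect classes modulo integers.\<close>
    have "bij_betw (\<lambda>x. vec_frac (k0 + x)) (K \<inter> unit_cell) C"
    proof (rule bij_betwI')
      fix x y assume "x \<in> K \<inter> unit_cell" "y \<in> K \<inter> unit_cell"
      then show "vec_frac (k0 + x) = vec_frac (k0 + y) \<longleftrightarrow> x = y"
        using vec_frac_eq_iff[of "k0 + x" "k0 + y"] unit_cell_eqI[of x y] by auto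
    next
      fix x assume x: "x \<in> K \<inter> unit_cell"
      have "(k0 + x) - vec_frac (k0 + x) \<in> K"
        using x s by (intro superlattice_lattice[OF K diff_vec_frac_lattice]) (simp add: superlattice_supp[OF K])
      from superlattice_diff[OF K _ this, of x] x
      show "vec_frac (k0 + x) \<in> C" by (simp add: C algebra_simps)
    next
      fix k assume k: "k \<in> C"
      define x where "x = vec_frac (k - k0)"
      have "x \<in> K \<inter> unit_cell" using k superlattice_vec_frac[OF K] by (simp add: C x_def)
      moreover have "vec_frac (k0 + x) = vec_frac k"
        using diff_vec_frac_lattice[of "k - k0"]
        by (subst eq_commute, subst vec_frac_eq_iff) (simp add: x_def algebra_simps)
      ultimately show "\<exists>x\<in>K \<inter> unit_cell. k = vec_frac (k0 + x)"
        using k by (auto simp: C vec_frac_unit_cell)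
    qed
    then show ?thesis using bij_betw_same_card n_def by metis
  qed
  have fin': "finite (lift_cosets b I K)"
    using finite_UnionD[OF finite_subset[OF sub finU]] .
  have "n * card (lift_cosets b I K) = card (\<Union>(lift_cosets b I K))"
  proof (rule card_partition[OF fin' finite_subset[OF sub finU] card_eq])
    fix C D assume CD: "C \<in> lift_cosets b I K" "D \<in> lift_cosets b I K" "C \<noteq> D"
    obtain c d where C: "C = {k \<in> unit_cell. k - c \<in> K}" and D: "D = {k \<in> unit_cell. k - d \<in> K}"
      using CD by (auto simp: lift_cosets_def)
    show "C \<inter> D = {}"
    proof (rule ccontr)
      assume "C \<inter> D \<noteq> {}"
      then obtain z where "z - c \<in> K" "z - d \<in> K" by (auto simp: C D)
      from superlattice_diff[OF K this] have dc: "d - c \<in> K" by simp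
      have "k - c \<in> K \<longleftrightarrow> k - d \<in> K" for k
        using superlattice_diff[OF K, of "k - c" "d - c"] superlattice_add[OF K, of "k - d" "d - c"] dc by auto
      with CD(3) show False by (simp add: C D)
    qed
  qed
  also have "\<dots> \<le> card U" by (rule card_mono[OF finU sub])
  also have "\<dots> \<le> n * b ^ card I" by (rule cardU)
  finally have "card (lift_cosets b I K) \<le> b ^ card I" using npos by simp
  with fin' show ?thesis by blast
qed

text \<open>For a coset \<open>C\<close> this is the group generated by \<open>K\<close> and one
  vector \<open>c + axis i (1 / real b)\<close>. Ranging over all \<open>c\<close> in
  \<open>C\<close> avoids choosing a representative.\<close>

definition extension_lattice :: "'n \<Rightarrow> nat \<times> (real ^ 'n) set \<times> (real ^ 'n) set \<Rightarrow> (real ^ 'n) set" where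
  "extension_lattice i = (\<lambda>(b, K, C). {x. \<exists>m::int. \<exists>c\<in>C. x - of_int m *\<^sub>R (c + axis i (1 / real b)) \<in> K})"

definition superlattices :: "'n set \<Rightarrow> nat \<Rightarrow> (real ^ 'n) set set" where
  "superlattices I M = {L. superlattice I L \<and> finite (L \<inter> unit_cell) \<and> card (L \<inter> unit_cell) \<le> M}"

text \<open>The \<open>i\<close>-th coordinates of \<open>L\<close> form a cyclic group (1/b)Z. With
  \<open>K\<close> the kernel of that coordinate, \<open>L\<close> is generated by \<open>K\<close>
  and any vector \<open>w\<close> with \<open>i\<close>-th coordinate 1/b, and only the class of
  \<open>w\<close> modulo \<open>K\<close> matters.\<close>

lemma superlattice_decompose:
  fixes L :: "(real ^ 'n) set"
  assumes i: "i \<notin> I" and "L \<in> superlattices (insert i I) M"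
  obtains b K C where "b \<in> {1..M}" "K \<in> superlattices I (M div b)" "C \<in> lift_cosets b I K"
    "L = extension_lattice i (b, K, C)"
proof -
  have L: "superlattice (insert i I) L" and fin: "finite (L \<inter> unit_cell)"
    and card: "card (L \<inter> unit_cell) \<le> M"
    using assms(2) by (auto simp: superlattices_def)
  define e where "e = (axis i 1 :: real ^ 'n)"
  have e: "e \<in> L"
    by (rule superlattice_lattice[OF L]) (auto simp: e_def lattice_points_def axis_def)
  \<comment> \<open>Adding \<open>e\<close> keeps the set nonempty when all \<open>i\<close>-th
    coordinates in \<open>L\<close> are integers: cell points then have \<open>i\<close>-th
    coordinate 0. This is the case b = 1.\<close>
  define A where "A = insert e {x \<in> L \<inter> unit_cell. x $ i > 0}"
  have "finite A" "A \<noteq> {}"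
    using finite_subset[OF _ fin, of "{x \<in> L \<inter> unit_cell. x $ i > 0}"] by (auto simp: A_def)
  then obtain w where w: "w \<in> A" and wmin: "\<And>x. x \<in> A \<Longrightarrow> w $ i \<le> x $ i"
    using arg_min_if_finite[of A "\<lambda>x. x $ i"] by (meson linorder_not_le)
  have wL: "w \<in> L" and wpos: "w $ i > 0" and wle: "w $ i \<le> 1"
    using w e wmin[of e] by (auto simp: A_def e_def)
  \<comment> \<open>Division with remainder: a positive remainder is below 1, so it survives
    reduction to the cell and would contradict the minimality of \<open>w $ i\<close>.\<close>
  have mult: "\<exists>q::int. x $ i = of_int q * w $ i" if x: "x \<in> L" for x
  proof -
    define q where "q = \<lfloor>x $ i / w $ i\<rfloor>"
    define y where "y = x - of_int q *\<^sub>R w"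
    have y: "y \<in> L" unfolding y_def
      by (intro superlattice_diff[OF L] x superlattice_scale[OF L] wL)
    have "of_int q \<le> x $ i / w $ i" "x $ i / w $ i < of_int q + 1" by (auto simp: q_def)
    then have yi: "0 \<le> y $ i" "y $ i < w $ i" using wpos by (auto simp: y_def field_simps)
    have "\<not> y $ i > 0"
    proof
      assume p: "y $ i > 0"
      have fr: "frac (y $ i) = y $ i" using yi wle by (simp add: frac_eq)
      then have "vec_frac y \<in> A" using p superlattice_vec_frac[OF L y] by (simp add: A_def)
      from wmin[OF this] fr yi show False by simp
    qed
    with yi have "y $ i = 0" by simp
    then show ?thesis by (intro exI[of _ q]) (simp add: y_def)
  qed
  \<comment> \<open>Since \<open>e\<close> lies in \<open>L\<close>, 1 is a multiple of
    \<open>w $ i\<close>, which is therefore 1/b.\<close>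
  obtain q :: int where q: "1 = of_int q * w $ i" using mult[OF e] by (auto simp: e_def)
  have "q > 0" using q wpos by (metis of_int_0_less_iff zero_less_mult_pos2 zero_less_one)
  define b where "b = nat q"
  have b: "b > 0" and wi: "w $ i = 1 / real b"
    using q \<open>q > 0\<close> by (auto simp: b_def field_simps)
  define K where "K = {x \<in> L. x $ i = 0}"
  have K: "superlattice I K"
    unfolding superlattice_def
  proof (intro conjI ballI allI impI)
    fix x j assume "x \<in> K" "j \<notin> I"
    then show "x $ j = 0" using superlattice_supp[OF L, of x j] by (cases "j = i") (auto simp: K_def)
  next
    fix x y assume "x \<in> K" "y \<in> K"
    then show "x - y \<in> K" using superlattice_diff[OF L] by (simp add: K_def)
  next
    fix x :: "real ^ 'n" assume "x \<in> lattice_points" "\<forall>j. j \<notin> I \<longrightarrow> x $ j = 0"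
    then show "x \<in> K" using superlattice_lattice[OF L, of x] i by (simp add: K_def)
  qed
  have finK: "finite (K \<inter> unit_cell)" using fin by (rule rev_finite_subset) (auto simp: K_def)
  \<comment> \<open>The translates of \<open>K\<close> by 0, w, ..., (b-1)w are told apart by their
    \<open>i\<close>-th coordinates j/b. Hence the index of \<open>L\<close> is at least
    \<open>b\<close> times that of \<open>K\<close>.\<close>
  define h where "h = (\<lambda>(j::nat, k). vec_frac (of_int (int j) *\<^sub>R w + k))"
  have "card ({..<b} \<times> (K \<inter> unit_cell)) \<le> card (L \<inter> unit_cell)"
  proof (rule card_inj_on_le[of h])
    show "inj_on h ({..<b} \<times> (K \<inter> unit_cell))"
    proof (rule inj_onI)
      fix p p' assume "p \<in> {..<b} \<times> (K \<inter> unit_cell)" "p' \<in> {..<b} \<times> (K \<inter> unit_cell)" "h p = h p'"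
      then obtain j k j' k' where p: "p = (j, k)" "p' = (j', k')"
        and a: "j < b" "j' < b" "k \<in> K" "k' \<in> K" "k \<in> unit_cell" "k' \<in> unit_cell"
        and "h (j, k) = h (j', k')"
        by (cases p; cases p') auto
      then have eq: "vec_frac (of_int (int j) *\<^sub>R w + k) = vec_frac (of_int (int j') *\<^sub>R w + k')"
        by (simp add: h_def)
      then have "frac (real j / real b) = frac (real j' / real b)"
        using a(3,4) by (auto simp: vec_eq_iff K_def wi dest: spec[of _ i])
      moreover have "frac (real m / real b) = real m / real b" if "m < b" for m
        using that by (simp add: frac_eq)
      ultimately have "j = j'" using a(1,2) b by simp
      moreover from eq this have "k - k' \<in> lattice_points" by (simp add: vec_frac_eq_iff)
      ultimately show "p = p'" using a p unit_cell_eqI by blast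
    qed
    show "h ` ({..<b} \<times> (K \<inter> unit_cell)) \<subseteq> L \<inter> unit_cell"
      by (auto simp: h_def K_def intro!: superlattice_vec_frac[OF L] superlattice_add[OF L]
          superlattice_scale[OF L, of _ "int _", simplified] wL)
  qed (rule fin)
  with card have bK: "b * card (K \<inter> unit_cell) \<le> M" by (simp add: card_cartesian_product)
  have "card (K \<inter> unit_cell) > 0"
    using finK superlattice_zero[OF K] by (auto simp: card_gt_0_iff)
  then have "b \<le> M" using bK by (metis dual_order.trans le_add1 mult.right_neutral mult_le_mono2 Suc_leI One_nat_def)
  have "card (K \<inter> unit_cell) \<le> M div b" using bK b by (simp add: less_eq_div_iff_mult_less_eq mult.commute)
  with K finK have Kin: "K \<in> superlattices I (M div b)" by (simp add: superlattices_def)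
  define k0 where "k0 = w - axis i (1 / real b)"
  define C where "C = {k \<in> unit_cell. k - k0 \<in> K}"
  have supp0: "k0 $ j = 0" if "j \<notin> I" for j
    using superlattice_supp[OF L wL, of j] that wi by (cases "j = i") (auto simp: k0_def axis_def)
  \<comment> \<open>\<open>k0\<close> lies in (1/b)K because \<open>b w - e\<close> is in
    \<open>L\<close> and has \<open>i\<close>-th coordinate 0.\<close>
  have "real b *\<^sub>R axis i (1 / real b) = e" using b by (auto simp: e_def axis_def vec_eq_iff)
  then have "real b *\<^sub>R k0 = of_int (int b) *\<^sub>R w - e" by (simp add: k0_def scaleR_diff_right)
  also have "\<dots> \<in> L" by (intro superlattice_diff[OF L] superlattice_scale[OF L] wL e)
  finally have "real b *\<^sub>R k0 \<in> K" using supp0[OF i] by (simp add: K_def)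
  with supp0 have Cin: "C \<in> lift_cosets b I K" by (auto simp: lift_cosets_def C_def)
  have CL: "c + axis i (1 / real b) \<in> L" "(c + axis i (1 / real b)) $ i = 1 / real b" if "c \<in> C" for c
  proof -
    have d: "c - k0 \<in> L" "(c - k0) $ i = 0" using that by (auto simp: C_def K_def)
    from superlattice_add[OF L d(1) wL] show "c + axis i (1 / real b) \<in> L" by (simp add: k0_def)
    show "(c + axis i (1 / real b)) $ i = 1 / real b" using d(2) supp0[OF i] by simp
  qed
  have "vec_frac k0 \<in> C"
  proof -
    have "k0 - vec_frac k0 \<in> K"
      by (rule superlattice_lattice[OF K diff_vec_frac_lattice]) (simp add: supp0)
    from superlattice_diff[OF K superlattice_zero[OF K] this] show ?thesis by (simp add: C_def)
  qed
  have "L = extension_lattice i (b, K, C)"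
  proof (intro equalityI subsetI)
    fix x assume x: "x \<in> L"
    obtain m :: int where m: "x $ i = of_int m * w $ i" using mult[OF x] by blast
    let ?c = "vec_frac k0 + axis i (1 / real b)"
    have "x - of_int m *\<^sub>R ?c \<in> L"
      by (intro superlattice_diff[OF L] superlattice_scale[OF L] x CL \<open>vec_frac k0 \<in> C\<close>)
    moreover have "(x - of_int m *\<^sub>R ?c) $ i = 0"
      using supp0[OF i] m wi by simp
    ultimately have "x - of_int m *\<^sub>R ?c \<in> K" unfolding K_def by blast
    then show "x \<in> extension_lattice i (b, K, C)"
      using \<open>vec_frac k0 \<in> C\<close> unfolding extension_lattice_def by blast
  next
    fix x assume "x \<in> extension_lattice i (b, K, C)"
    then obtain m :: int and c where c: "c \<in> C" "x - of_int m *\<^sub>R (c + axis i (1 / real b)) \<in> L"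
      by (auto simp: extension_lattice_def K_def)
    from superlattice_add[OF L c(2) superlattice_scale[OF L CL(1)[OF c(1)], of m]] show "x \<in> L" by simp
  qed
  with that[of b K C] \<open>b \<le> M\<close> b Kin Cin show ?thesis by simp
qed

lemma card_superlattices:
  fixes I :: "'n::finite set"
  shows "finite (superlattices I M) \<and> card (superlattices I M) \<le> M ^ (card I + 1)"
proof -
  have "finite I" by simp
  then show ?thesis
  proof (induction I arbitrary: M rule: finite_induct)
    case empty
    \<comment> \<open>The origin is always a cell point, so every index is at least 1 and M = 0
      leaves no lattice.\<close>
    have "superlattices ({} :: 'n set) M \<subseteq> (if M = 0 then {} else {{0}})"
    proof
      fix L :: "(real ^ 'n) set" assume "L \<in> superlattices {} M"
      then have L: "superlattice {} L" and f: "finite (L \<inter> unit_cell)" and c: "card (L \<inter> unit_cell) \<le> M"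
        by (auto simp: superlattices_def)
      have z: "0 \<in> L" by (rule superlattice_zero[OF L])
      have "x = 0" if "x \<in> L" for x using superlattice_supp[OF L that] by (simp add: vec_eq_iff)
      with z have "L = {0}" by auto
      moreover have "card (L \<inter> unit_cell) > 0" using z f by (auto simp: card_gt_0_iff)
      then have "M \<noteq> 0" using c by simp
      ultimately show "L \<in> (if M = 0 then {} else {{0}})" by simp
    qed
    then show ?case
      by (auto split: if_splits intro: finite_subset dest: card_mono[rotated])
  next
    case (insert i I)
    define T where "T = (SIGMA b:{1..M}. SIGMA K:superlattices I (M div b). lift_cosets b I K)"
    have sub: "superlattices (insert i I) M \<subseteq> extension_lattice i ` T"
    proof
      fix L assume "L \<in> superlattices (insert i I) M"
      from superlattice_decompose[OF insert.hyps(2) this] obtain b K C where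
        "b \<in> {1..M}" "K \<in> superlattices I (M div b)" "C \<in> lift_cosets b I K" "L = extension_lattice i (b, K, C)" .
      then show "L \<in> extension_lattice i ` T" unfolding T_def by blast
    qed
    have C: "finite (lift_cosets b I K)" "card (lift_cosets b I K) \<le> b ^ card I"
      if "b \<in> {1..M}" "K \<in> superlattices I (M div b)" for b K
      using card_lift_cosets[of I K b] that by (auto simp: superlattices_def)
    have finI: "finite (SIGMA K:superlattices I (M div b). lift_cosets b I K)" if "b \<in> {1..M}" for b
      using insert.IH[of "M div b"] C[OF that] by (intro finite_SigmaI) auto
    have finT: "finite T" unfolding T_def by (rule finite_SigmaI) (simp, erule finI)
    have "card T = (\<Sum>b=1..M. card (SIGMA K:superlattices I (M div b). lift_cosets b I K))"
      unfolding T_def by (subst card_SigmaI) (use finI in blast)+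
    also have "\<dots> \<le> (\<Sum>b=1..M. M ^ (card I + 1))"
    proof (rule sum_mono)
      fix b assume b: "b \<in> {1..M}"
      have "card (SIGMA K:superlattices I (M div b). lift_cosets b I K)
            = (\<Sum>K\<in>superlattices I (M div b). card (lift_cosets b I K))"
        using insert.IH[of "M div b"] C[OF b] by (subst card_SigmaI) auto
      \<comment> \<open>One spare factor \<open>b\<close> is conceded so that both powers have the
        same exponent and combine to a power of \<open>M div b * b\<close>, at most
        \<open>M\<close>.\<close>
      also have "\<dots> \<le> card (superlattices I (M div b)) * b ^ card I"
        using sum_bounded_above[of "superlattices I (M div b)" "\<lambda>K. card (lift_cosets b I K)"] C(2)[OF b] by simp
      also have "\<dots> \<le> (M div b) ^ (card I + 1) * b ^ (card I + 1)"
        using insert.IH[of "M div b"] b by (intro mult_mono power_increasing) auto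
      also have "\<dots> = (M div b * b) ^ (card I + 1)" by (simp only: power_mult_distrib)
      also have "\<dots> \<le> M ^ (card I + 1)" by (intro power_mono) auto
      finally show "card (SIGMA K:superlattices I (M div b). lift_cosets b I K) \<le> M ^ (card I + 1)" .
    qed
    also have "\<dots> = M ^ (card (insert i I) + 1)" using insert.hyps by simp
    finally have "card T \<le> M ^ (card (insert i I) + 1)" .
    with sub finT show ?case
      by (meson card_image_le card_mono finite_imageI finite_subset le_trans)
  qed
qed

subsection \<open>Volume of the cross-polytope and packing\<close>

definition crosspolytope :: "(real ^ 'n) set" where
  "crosspolytope = {x. (\<Sum>j\<in>UNIV. \<bar>x $ j\<bar>) \<le> 1}"

lemma sum_Basis_cart: "(\<Sum>b\<in>Basis. f b) = (\<Sum>j\<in>UNIV. f (axis j 1 :: real ^ 'n))"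
proof -
  have Basis: "(Basis :: (real ^ 'n) set) = range (\<lambda>j. axis j 1)"
    by (auto simp: Basis_vec_def)
  have "inj (\<lambda>j. axis j 1 :: real ^ 'n)"
    by (simp add: inj_on_def axis_eq_axis)
  then show ?thesis unfolding Basis by (subst sum.reindex) simp_all
qed

lemma finite_bounded_lattice_points:
  fixes S :: "(real ^ 'n) set"
  assumes "bounded S"
  shows "finite (S \<inter> lattice_points)"
proof -
  obtain B where B: "\<And>x. x \<in> S \<Longrightarrow> norm x \<le> B" using assms by (auto simp: bounded_iff)
  define N where "N = \<lceil>B\<rceil>"
  have "S \<inter> lattice_points \<subseteq> (\<lambda>f. \<chi> j. of_int (f j)) ` (UNIV \<rightarrow>\<^sub>E {-N..N})"
  proof
    fix x assume x: "x \<in> S \<inter> lattice_points"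
    have "\<lfloor>x $ j\<rfloor> \<in> {-N..N}" for j
    proof -
      have "\<bar>x $ j\<bar> \<le> of_int N"
        using component_le_norm_cart[of x j] B[of x] x unfolding N_def by (simp, linarith)
      then show ?thesis by (simp add: abs_le_iff, linarith)
    qed
    moreover have "x = (\<chi> j. of_int \<lfloor>x $ j\<rfloor>)"
      using x by (auto simp: vec_eq_iff lattice_points_def elim!: Ints_cases dest: spec)
    ultimately show "x \<in> (\<lambda>f. \<chi> j. of_int (f j)) ` (UNIV \<rightarrow>\<^sub>E {-N..N})"
      by (intro image_eqI[of _ _ "\<lambda>j. \<lfloor>x $ j\<rfloor>"]) auto
  qed
  then show ?thesis by (rule finite_subset) (intro finite_imageI finite_PiE, auto)
qed

text \<open>A diagonal map with entries of absolute value 1 preserves volume. It carries the part of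
  the cross-polytope in any orthant to the standard simplex.\<close>

lemma emeasure_lborel_sign_flip:
  fixes A :: "(real ^ 'n) set" and c :: "'n \<Rightarrow> real"
  assumes c: "\<And>j. \<bar>c j\<bar> = 1" and A: "A \<in> sets borel"
  shows "emeasure lborel {x. (\<chi> j. c j * x $ j) \<in> A} = emeasure lborel A"
proof -
  \<comment> \<open>The signs are re-indexed by basis vectors, the form in which
    \<open>lborel_affine_euclidean\<close> takes its coefficients.\<close>
  define c' where "c' = (\<lambda>v :: real ^ 'n. v \<bullet> (\<chi> j. c j))"
  define T where "T = (\<lambda>x :: real ^ 'n. 0 + (\<Sum>j\<in>Basis. (c' j * (x \<bullet> j)) *\<^sub>R j))"
  have ax: "c' (axis j 1) = c j" for j
    by (simp add: c'_def inner_axis')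
  have abs: "\<bar>c' j\<bar> = 1" if "j \<in> Basis" for j
    using that c by (auto simp: Basis_vec_def ax)
  have T: "T x = (\<chi> j. c j * x $ j)" for x
    by (simp add: T_def sum_Basis_cart ax inner_axis vec_eq_iff)
      (simp add: axis_def if_distrib cong: if_cong)
  have [measurable]: "T \<in> borel \<rightarrow>\<^sub>M borel"
    by (simp add: T_def[abs_def])
  have "lborel = density (distr lborel borel T) (\<lambda>_. (\<Prod>j\<in>Basis. \<bar>c' j\<bar>))"
    unfolding T_def by (rule lborel_affine_euclidean) (use abs in force)
  also have "\<dots> = distr lborel borel T"
    by (simp add: abs density_1)
  finally have "emeasure lborel A = emeasure (distr lborel borel T) A" by simp
  also have "\<dots> = emeasure lborel (T -` A \<inter> space lborel)"
    by (rule emeasure_distr) (use A in auto)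
  also have "T -` A \<inter> space lborel = {x. (\<chi> j. c j * x $ j) \<in> A}"
    by (auto simp: T)
  finally show ?thesis by simp
qed

lemma closed_crosspolytope: "closed (crosspolytope :: (real ^ 'n) set)"
  unfolding crosspolytope_def by (intro closed_Collect_le continuous_intros)

lemma compact_crosspolytope: "compact (crosspolytope :: (real ^ 'n) set)"
proof -
  have "crosspolytope \<subseteq> cbox (-1) (1 :: real ^ 'n)"
  proof
    fix x :: "real ^ 'n" assume "x \<in> crosspolytope"
    then have "\<bar>x $ j\<bar> \<le> 1" for j
      using member_le_sum[of j UNIV "\<lambda>j. \<bar>x $ j\<bar>"] by (simp add: crosspolytope_def)
    then show "x \<in> cbox (-1) 1" by (simp add: mem_box_cart abs_le_iff minus_le_iff)
  qed
  then have "bounded (crosspolytope :: (real ^ 'n) set)" using bounded_cbox bounded_subset by blast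
  with closed_crosspolytope show ?thesis by (simp add: compact_eq_bounded_closed)
qed

text \<open>Each of the 2^d orthants cuts out a reflected standard simplex of volume 1/d!, and two
  of these meet only inside a coordinate hyperplane.\<close>

lemma measure_crosspolytope:
  "measure lebesgue (crosspolytope :: (real ^ 'n) set) = 2 ^ CARD('n) / fact CARD('n)"
proof -
  define S where "S = {x :: real ^ 'n. (\<forall>j. 0 \<le> x $ j) \<and> (\<Sum>j\<in>UNIV. x $ j) \<le> 1}"
  define F where "F = (\<lambda>s. {x :: real ^ 'n. (\<chi> j. (if j \<in> s then 1 else -1) * x $ j) \<in> S})"
  have S: "S = convex hull (insert 0 Basis)"
    unfolding std_simplex S_def sum_Basis_cart
    by (auto simp: inner_axis Basis_vec_def)
  have "closed S" unfolding S_def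
    by (intro closed_Collect_conj closed_Collect_all closed_Collect_le continuous_intros)
  have closedF: "closed (F s)" for s
    unfolding F_def using closed_vimage[OF \<open>closed S\<close>, of "\<lambda>x. \<chi> j. (if j \<in> s then 1 else -1) * x $ j"]
    by (simp add: vimage_def continuous_intros)
  have em: "emeasure lborel (F s) = ennreal (1 / fact CARD('n))" for s
  proof -
    have "emeasure lborel (F s) = emeasure lborel S"
      unfolding F_def using \<open>closed S\<close> by (intro emeasure_lborel_sign_flip) auto
    then show ?thesis by (simp add: S emeasure_std_simplex)
  qed
  have m: "measure lebesgue (F s) = 1 / fact CARD('n)" for s
    using em[of s] closedF by (simp add: measure_def)
  have lm: "F s \<in> lmeasurable" for s
    using em[of s] closedF by (intro fmeasurableI) auto
  have U: "crosspolytope = (\<Union>s\<in>UNIV. F s)"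
  proof (intro equalityI subsetI)
    fix x :: "real ^ 'n" assume "x \<in> crosspolytope"
    moreover have "(if 0 \<le> x $ j then 1 else -1) * x $ j = \<bar>x $ j\<bar>" for j by simp
    ultimately have "x \<in> F {j. 0 \<le> x $ j}"
      by (simp add: F_def S_def crosspolytope_def del: mult_minus1)
    then show "x \<in> (\<Union>s\<in>UNIV. F s)" by blast
  next
    fix x assume "x \<in> (\<Union>s\<in>UNIV. F s)"
    then obtain s where s: "x \<in> F s" by blast
    then have "\<bar>x $ j\<bar> = (if j \<in> s then 1 else -1) * x $ j" for j
      by (auto simp: F_def S_def dest!: spec[of _ j])
    with s show "x \<in> crosspolytope" by (simp add: F_def S_def crosspolytope_def)
  qed
  have "measure lebesgue (\<Union>s\<in>UNIV. F s) = (\<Sum>s\<in>UNIV. measure lebesgue (F s))"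
  proof (rule measure_negligible_finite_Union_image)
    show "pairwise (\<lambda>s t. negligible (F s \<inter> F t)) UNIV"
    proof (rule pairwiseI)
      fix s t :: "'n set" assume "s \<noteq> t"
      then obtain j where j: "j \<in> s \<longleftrightarrow> j \<notin> t" by blast
      have "F s \<inter> F t \<subseteq> {x. axis j 1 \<bullet> x = 0}"
        using j by (auto simp: F_def S_def inner_axis' dest!: spec[of _ j] split: if_splits)
      moreover have "negligible {x :: real ^ 'n. axis j 1 \<bullet> x = 0}"
        by (rule negligible_hyperplane) (simp add: axis_eq_0_iff)
      ultimately show "negligible (F s \<inter> F t)" by (rule negligible_subset[rotated])
    qed
  qed (use lm in auto)
  then show ?thesis by (simp add: U m card_UNIV_set)
qed

text \<open>Reduction modulo the integer lattice moves such a set piecewise and injectively into the unit cell.\<close>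

lemma measure_le_1_if_inj_mod_lattice:
  fixes A :: "(real ^ 'n) set"
  assumes A: "A \<in> lmeasurable" "bounded A"
    and inj: "\<And>x y. x \<in> A \<Longrightarrow> y \<in> A \<Longrightarrow> x - y \<in> lattice_points \<Longrightarrow> x = y"
  shows "measure lebesgue A \<le> 1"
proof -
  \<comment> \<open>\<open>Z\<close> collects the integer parts of the points of \<open>A\<close>;
    the disjoint cells \<open>Q z\<close> for \<open>z\<close> in \<open>Z\<close> cut
    \<open>A\<close> into pieces, which \<open>G\<close> later moves into
    \<open>unit_cell\<close>.\<close>
  define Q where "Q = (\<lambda>z :: real ^ 'n. (+) z ` unit_cell)"
  define Z where "Z = {x - vec_frac x | x. x \<in> A}"
  have cellm: "(unit_cell :: (real ^ 'n) set) \<in> sets lebesgue"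
  proof -
    have "(unit_cell :: (real ^ 'n) set) = (\<Inter>j. {x. 0 \<le> x $ j} \<inter> {x. x $ j < 1})"
      by (auto simp: unit_cell_def)
    also have "\<dots> \<in> sets borel"
      by (intro sets.finite_INT sets.Int borel_closed borel_open closed_Collect_le open_Collect_less continuous_intros) auto
    finally show ?thesis by simp
  qed
  have cellbd: "(unit_cell :: (real ^ 'n) set) \<subseteq> cbox 0 1"
    by (auto simp: unit_cell_def mem_box_cart less_imp_le)
  have memQ: "x \<in> Q z \<longleftrightarrow> x - z \<in> unit_cell" for x z
    by (force simp: Q_def image_iff)
  have Zlat: "z \<in> lattice_points" if "z \<in> Z" for z
    using that diff_vec_frac_lattice by (auto simp: Z_def)
  have cellbd': "bounded (unit_cell :: (real ^ 'n) set)"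
    using bounded_subset[OF bounded_cbox cellbd] .
  have "Z \<subseteq> (\<Union>x\<in>A. \<Union>y\<in>unit_cell. {x - y}) \<inter> lattice_points"
  proof
    fix z assume z: "z \<in> Z"
    then obtain x where "x \<in> A" "z = x - vec_frac x" by (auto simp: Z_def)
    moreover from z have "z \<in> lattice_points" by (rule Zlat)
    ultimately show "z \<in> (\<Union>x\<in>A. \<Union>y\<in>unit_cell. {x - y}) \<inter> lattice_points"
      using vec_frac_in_unit_cell[of x] by blast
  qed
  then have finZ: "finite Z"
    by (rule finite_subset) (intro finite_bounded_lattice_points bounded_differences A(2) cellbd')
  define G where "G = (\<lambda>z. (\<lambda>x. x - z) ` (A \<inter> Q z))"
  have QL: "A \<inter> Q z \<in> lmeasurable" for z
    using A(1) lebesgue_sets_translation[OF cellm, of z] by (auto simp: Q_def intro: fmeasurable_Int_fmeasurable)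
  then have GL: "G z \<in> lmeasurable" for z
    unfolding G_def by (rule measurable_translation_subtract)
  have AU: "A = (\<Union>z\<in>Z. A \<inter> Q z)"
    by (auto simp: Z_def memQ)
  have "measure lebesgue A = measure lebesgue (\<Union>z\<in>Z. A \<inter> Q z)" using AU by simp
  also have "\<dots> = (\<Sum>z\<in>Z. measure lebesgue (A \<inter> Q z))"
  proof (rule measure_negligible_finite_Union_image[OF finZ QL])
    show "pairwise (\<lambda>z z'. negligible (A \<inter> Q z \<inter> (A \<inter> Q z'))) Z"
    proof (rule pairwiseI)
      fix z z' assume z: "z \<in> Z" "z' \<in> Z" "z \<noteq> z'"
      have "A \<inter> Q z \<inter> (A \<inter> Q z') = {}"
      proof (rule ccontr)
        assume "A \<inter> Q z \<inter> (A \<inter> Q z') \<noteq> {}"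
        then obtain x where x: "x - z \<in> unit_cell" "x - z' \<in> unit_cell" using memQ by blast
        have "(x - z) - (x - z') \<in> lattice_points"
          using Zlat[OF z(1)] Zlat[OF z(2)] by (simp add: lattice_points_def)
        from unit_cell_eqI[OF x this] z(3) show False by simp
      qed
      then show "negligible (A \<inter> Q z \<inter> (A \<inter> Q z'))" by simp
    qed
  qed
  also have "\<dots> = (\<Sum>z\<in>Z. measure lebesgue (G z))"
    by (simp add: G_def measure_translation_subtract)
  also have "\<dots> = measure lebesgue (\<Union>z\<in>Z. G z)"
  proof (rule measure_negligible_finite_Union_image[OF finZ GL, symmetric])
    show "pairwise (\<lambda>z z'. negligible (G z \<inter> G z')) Z"
    proof (rule pairwiseI)
      fix z z' assume z: "z \<in> Z" "z' \<in> Z" "z \<noteq> z'"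
      \<comment> \<open>A common point would come from two points of \<open>A\<close> that differ by
        the integer vector \<open>z - z'\<close>; they coincide by \<open>inj\<close>, which forces
        z = z'.\<close>
      have "G z \<inter> G z' = {}"
      proof (rule ccontr)
        assume "G z \<inter> G z' \<noteq> {}"
        then obtain a a' where a: "a \<in> A" "a' \<in> A" "a - z = a' - z'" by (auto simp: G_def)
        have e: "a - a' = z - z'" using a(3) by (simp add: algebra_simps)
        have "z - z' \<in> lattice_points" using Zlat[OF z(1)] Zlat[OF z(2)] by (simp add: lattice_points_def)
        then have "a = a'" using inj[OF a(1,2)] e by simp
        with e z show False by simp
      qed
      then show "negligible (G z \<inter> G z')" by simp
    qed
  qed
  also have "\<dots> \<le> measure lebesgue (cbox 0 (1 :: real ^ 'n))"
  proof (rule measure_mono_fmeasurable)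
    show "(\<Union>z\<in>Z. G z) \<subseteq> cbox 0 1" using cellbd by (auto simp: G_def memQ)
    show "(\<Union>z\<in>Z. G z) \<in> sets lebesgue" using GL finZ by (intro sets.finite_UN) auto
  qed auto
  also have "\<dots> = 1"
  proof -
    have "0 \<in> cbox 0 (1 :: real ^ 'n)" by (simp add: mem_box_cart)
    then have "cbox 0 (1 :: real ^ 'n) \<noteq> {}" by blast
    then show ?thesis by (simp add: content_cbox_cart)
  qed
  finally show ?thesis .
qed

text \<open>Half-size cross-polytopes centred at the cell points of \<open>L\<close> stay disjoint
  modulo integers, so their total volume is at most 1. Only the open cross-polytope is known to
  avoid \<open>L\<close>, hence the shrinking factor s < 1 and a final limit.\<close>

lemma card_le_fact_of_crosspolytope_packing:
  fixes L :: "(real ^ 'n) set"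
  assumes L: "superlattice UNIV L"
    and empty: "\<And>x. x \<in> L \<Longrightarrow> (\<Sum>j\<in>UNIV. \<bar>x $ j\<bar>) < 1 \<Longrightarrow> x = 0"
  shows "finite (L \<inter> unit_cell)" and "card (L \<inter> unit_cell) \<le> fact CARD('n)"
proof -
  \<comment> \<open>Finite subsets come first, since finiteness of
    \<open>L \<inter> unit_cell\<close> is itself part of the claim.\<close>
  have main: "card F \<le> fact CARD('n)" if F: "F \<subseteq> L \<inter> unit_cell" "finite F" for F
  proof -
    have bound: "s ^ CARD('n) * real (card F) \<le> fact CARD('n)" if s: "0 < s" "s < 1" for s :: real
    proof -
      define T where "T = (\<lambda>l :: real ^ 'n. (\<lambda>x. (s / 2) *\<^sub>R x + l) ` crosspolytope)"
      have mT: "measure lebesgue (T l) = s ^ CARD('n) / fact CARD('n)" for l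
        using s by (simp add: T_def measure_lebesgue_affine measure_crosspolytope power_divide)
      have cT: "compact (T l)" for l
        unfolding T_def by (intro compact_continuous_image continuous_intros compact_crosspolytope)
      then have lT: "T l \<in> lmeasurable" for l
        by (simp add: lmeasurable_compact)
      \<comment> \<open>The difference of two points of the (s/2)-scaled body has coordinate sum of
        absolute values at most s < 1. If it also lies in \<open>L\<close> it is 0, so the centres
        differ by an integer vector and agree as cell points.\<close>
      have key: "l = l' \<and> x = x'" if "l \<in> F" "l' \<in> F" "x \<in> T l" "x' \<in> T l'" "x - x' \<in> lattice_points" for l l' x x'
      proof -
        from that(3,4) obtain c c' where c: "c \<in> crosspolytope" "x = (s/2) *\<^sub>R c + l"
          and c': "c' \<in> crosspolytope" "x' = (s/2) *\<^sub>R c' + l'"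
          by (auto simp: T_def)
        define d where "d = (s/2) *\<^sub>R (c - c')"
        have d: "d = (x - x') - (l - l')" by (simp add: d_def c c' algebra_simps)
        have "(\<Sum>j\<in>UNIV. \<bar>d $ j\<bar>) \<le> (\<Sum>j\<in>UNIV. (s/2) * (\<bar>c $ j\<bar> + \<bar>c' $ j\<bar>))"
          using s by (intro sum_mono) (auto simp: d_def abs_mult)
        also have "\<dots> = (s/2) * ((\<Sum>j\<in>UNIV. \<bar>c $ j\<bar>) + (\<Sum>j\<in>UNIV. \<bar>c' $ j\<bar>))"
          by (simp add: sum_distrib_left sum.distrib distrib_left)
        also have "\<dots> \<le> (s/2) * (1 + 1)"
          using c c' s by (intro mult_left_mono add_mono) (auto simp: crosspolytope_def)
        also have "\<dots> < 1" using s by simp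
        finally have small: "(\<Sum>j\<in>UNIV. \<bar>d $ j\<bar>) < 1" .
        have "x - x' \<in> L" by (rule superlattice_lattice[OF L that(5)]) simp
        moreover have "l - l' \<in> L" using that F by (intro superlattice_diff[OF L]) auto
        ultimately have "d \<in> L" unfolding d by (rule superlattice_diff[OF L])
        from empty[OF this small] have "x - x' = l - l'" using d by simp
        moreover from this that F have "l = l'" by (intro unit_cell_eqI) auto
        ultimately show ?thesis by simp
      qed
      have "real (card F) * (s ^ CARD('n) / fact CARD('n)) = (\<Sum>l\<in>F. measure lebesgue (T l))"
        by (simp add: mT)
      also have "\<dots> = measure lebesgue (\<Union>l\<in>F. T l)"
      proof (rule measure_negligible_finite_Union_image[symmetric, OF F(2) lT])
        have "0 \<in> (lattice_points :: (real ^ 'n) set)" by (simp add: lattice_points_def)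
        then have "T l \<inter> T l' = {}" if "l \<in> F" "l' \<in> F" "l \<noteq> l'" for l l'
          using key[OF that(1,2)] that(3) by (metis diff_self disjoint_iff)
        then show "pairwise (\<lambda>x y. negligible (T x \<inter> T y)) F"
          by (simp add: pairwise_def)
      qed
      also have "\<dots> \<le> 1"
      proof (rule measure_le_1_if_inj_mod_lattice)
        show "(\<Union>l\<in>F. T l) \<in> lmeasurable" using F lT by (intro fmeasurable.finite_UN) auto
        show "bounded (\<Union>l\<in>F. T l)"
          using F(2) cT by (intro bounded_UN) (auto simp: compact_imp_bounded)
        show "x = y" if "x \<in> (\<Union>l\<in>F. T l)" "y \<in> (\<Union>l\<in>F. T l)" "x - y \<in> lattice_points" for x y
        proof -
          from that(1,2) obtain l l' where "l \<in> F" "x \<in> T l" "l' \<in> F" "y \<in> T l'" by blast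
          with key[of l l' x y] that(3) show ?thesis by simp
        qed
      qed
      finally show ?thesis by (simp add: field_simps)
    qed
    have "real (card F) \<le> fact CARD('n)"
    proof (rule tendsto_upperbound)
      show "((\<lambda>s. s ^ CARD('n) * real (card F)) \<longlongrightarrow> real (card F)) (at_left (1::real))"
        by (auto intro!: tendsto_eq_intros)
      show "\<forall>\<^sub>F s in at_left (1::real). s ^ CARD('n) * real (card F) \<le> fact CARD('n)"
        using eventually_at_left_real[of 0 "1::real"] by (rule eventually_mono) (use bound in auto)
    qed simp
    then show ?thesis by (metis of_nat_fact of_nat_le_iff)
  qed
  show "finite (L \<inter> unit_cell)"
    using finite_if_finite_subsets_card_bdd[of "L \<inter> unit_cell" "fact CARD('n)"] main by blast
  then show "card (L \<inter> unit_cell) \<le> fact CARD('n)" using main by blast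
qed

subsection \<open>Unimodular equivalence and coordinates in a polytope\<close>

lemma matrix_inv_inverse:
  fixes A :: "real ^ 'n ^ 'n"
  assumes "invertible A"
  shows "A ** matrix_inv A = mat 1" "matrix_inv A ** A = mat 1"
proof -
  have "\<exists>B. A ** B = mat 1 \<and> B ** A = mat 1" using assms by (simp add: invertible_def)
  from someI_ex[OF this] show "A ** matrix_inv A = mat 1" "matrix_inv A ** A = mat 1"
    by (auto simp: matrix_inv_def)
qed

lemma matrix_inv_unique:
  fixes A B :: "real ^ 'n ^ 'n"
  assumes "A ** B = mat 1" "B ** A = mat 1"
  shows "matrix_inv A = B"
proof -
  have "invertible A" using assms by (auto simp: invertible_def)
  then have "matrix_inv A = matrix_inv A ** (A ** B)" "matrix_inv A ** A = mat 1"
    using matrix_inv_inverse assms by auto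
  then show ?thesis by (simp add: matrix_mul_assoc)
qed

text \<open>Trades the chosen \<open>matrix_inv\<close> for an arbitrary two-sided integral inverse,
  which products and inverses supply directly.\<close>

lemma GL_Z_iff:
  "A \<in> GL_Z \<longleftrightarrow> (\<forall>i j. A $ i $ j \<in> \<int>) \<and>
     (\<exists>B. A ** B = mat 1 \<and> B ** A = mat 1 \<and> (\<forall>i j. B $ i $ j \<in> \<int>))"
proof
  assume "A \<in> GL_Z"
  then show "(\<forall>i j. A $ i $ j \<in> \<int>) \<and>
      (\<exists>B. A ** B = mat 1 \<and> B ** A = mat 1 \<and> (\<forall>i j. B $ i $ j \<in> \<int>))"
    using matrix_inv_inverse[of A] by (auto simp: GL_Z_def)
next
  assume *: "(\<forall>i j. A $ i $ j \<in> \<int>) \<and>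
      (\<exists>B. A ** B = mat 1 \<and> B ** A = mat 1 \<and> (\<forall>i j. B $ i $ j \<in> \<int>))"
  then obtain B where B: "A ** B = mat 1" "B ** A = mat 1" "\<forall>i j. B $ i $ j \<in> \<int>" by blast
  from B(1,2) have "invertible A" unfolding invertible_def by blast
  with * B(3) show "A \<in> GL_Z" unfolding GL_Z_def by (simp add: matrix_inv_unique[OF B(1,2)])
qed

lemma GL_Z_mult: "A \<in> GL_Z \<Longrightarrow> B \<in> GL_Z \<Longrightarrow> A ** B \<in> GL_Z"
proof -
  assume "A \<in> GL_Z" "B \<in> GL_Z"
  then obtain A' B' where A: "\<And>i j. A $ i $ j \<in> \<int>" "A ** A' = mat 1" "A' ** A = mat 1" "\<And>i j. A' $ i $ j \<in> \<int>"
    and B: "\<And>i j. B $ i $ j \<in> \<int>" "B ** B' = mat 1" "B' ** B = mat 1" "\<And>i j. B' $ i $ j \<in> \<int>"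
    by (auto simp: GL_Z_iff)
  have "A ** B ** (B' ** A') = A ** (B ** B') ** A'" "B' ** A' ** (A ** B) = B' ** (A' ** A) ** B"
    by (simp_all add: matrix_mul_assoc)
  then have "A ** B ** (B' ** A') = mat 1" "B' ** A' ** (A ** B) = mat 1"
    using A B by simp_all
  moreover have "(A ** B) $ i $ j \<in> \<int>" "(B' ** A') $ i $ j \<in> \<int>" for i j
    using A B by (auto simp: matrix_matrix_mult_def intro!: Ints_sum Ints_mult)
  ultimately show ?thesis unfolding GL_Z_iff by blast
qed

lemma GL_Z_equiv_sym: "GL_Z_equiv P Q \<Longrightarrow> GL_Z_equiv Q P"
proof -
  assume "GL_Z_equiv P Q"
  then obtain A B where "\<forall>i j. A $ i $ j \<in> \<int>" and Q: "Q = (\<lambda>x. A *v x) ` P"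
    and AB: "A ** B = mat 1" "B ** A = mat 1" and "\<forall>i j. B $ i $ j \<in> \<int>"
    by (auto simp: GL_Z_equiv_def GL_Z_iff)
  then have "B \<in> GL_Z" by (auto simp: GL_Z_iff)
  moreover have "P = (\<lambda>x. B *v x) ` Q"
    by (simp add: Q image_image matrix_vector_mul_assoc AB)
  ultimately show ?thesis unfolding GL_Z_equiv_def by blast
qed

lemma GL_Z_equiv_trans: "GL_Z_equiv P Q \<Longrightarrow> GL_Z_equiv Q R \<Longrightarrow> GL_Z_equiv P R"
proof -
  assume "GL_Z_equiv P Q" "GL_Z_equiv Q R"
  then obtain A B where AB: "A \<in> GL_Z" "B \<in> GL_Z" "Q = (\<lambda>x. A *v x) ` P" "R = (\<lambda>x. B *v x) ` Q"
    by (auto simp: GL_Z_equiv_def)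
  then have "R = (\<lambda>x. (B ** A) *v x) ` P"
    by (simp add: image_image matrix_vector_mul_assoc)
  with GL_Z_mult[OF AB(2,1)] show ?thesis unfolding GL_Z_equiv_def by blast
qed

lemma integer_matrix_iff:
  fixes A :: "real ^ 'n ^ 'n"
  shows "(\<forall>i j. A $ i $ j \<in> \<int>) \<longleftrightarrow> (\<forall>x\<in>lattice_points. A *v x \<in> lattice_points)"
proof safe
  fix x :: "real ^ 'n" assume "\<forall>i j. A $ i $ j \<in> \<int>" "x \<in> lattice_points"
  then show "A *v x \<in> lattice_points"
    by (auto simp: lattice_points_def matrix_vector_mult_def intro!: Ints_sum Ints_mult)
next
  fix i j assume a: "\<forall>x\<in>lattice_points. A *v x \<in> lattice_points"
  have "axis j 1 \<in> (lattice_points :: (real ^ 'n) set)" by (simp add: lattice_points_def axis_def)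
  with a have "A *v axis j 1 \<in> lattice_points" by blast
  then show "A $ i $ j \<in> \<int>"
    by (simp add: matrix_vector_mult_basis column_def lattice_points_def)
qed

section \<open>Coordinates adapted to a polytope\<close>

lemma lattice_polytope_eq_hull:
  assumes "lattice_polytope P"
  shows "P = convex hull (P \<inter> lattice_points)"
proof -
  obtain S where S: "S \<subseteq> lattice_points" "P = convex hull S"
    using assms by (auto simp: lattice_polytope_def)
  have "S \<subseteq> P" using S(2) hull_subset by metis
  then have "convex hull S \<subseteq> convex hull (P \<inter> lattice_points)"
    using S(1) by (intro hull_mono) auto
  moreover have "convex P" using S(2) by simp
  then have "convex hull (P \<inter> lattice_points) \<subseteq> P" by (intro hull_minimal) auto
  ultimately show ?thesis using S(2) by blast
qed

lemma lattice_polytope_bounded: "lattice_polytope P \<Longrightarrow> bounded P"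
  by (auto simp: lattice_polytope_def intro: bounded_convex_hull finite_imp_bounded)

text \<open>The columns form a basis of the space but in general do not generate
  \<open>lattice_points\<close>; \<open>pullback_lattice\<close> records the discrepancy.\<close>

definition cube_basis :: "(real ^ 'n) set \<Rightarrow> real ^ 'n ^ 'n \<Rightarrow> bool" where
  "cube_basis P V \<longleftrightarrow> invertible V \<and> (\<forall>j. column j V \<in> P \<inter> lattice_points) \<and>
     (\<forall>a k. V *v a \<in> P \<inter> lattice_points \<longrightarrow> \<bar>a $ k\<bar> \<le> 1)"

text \<open>Lattice vectors in \<open>P\<close> of maximal determinant: by Cramer's rule, a coordinate of absolute value
  greater than 1 would allow an exchange that increases the determinant.\<close>

lemma exists_cube_basis:
  fixes P :: "(real ^ 'n) set"
  assumes P: "lattice_polytope P" "interior P \<noteq> {}"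
  shows "\<exists>V. cube_basis P V"
proof -
  define W where "W = P \<inter> lattice_points"
  have finW: "finite W" unfolding W_def
    by (intro finite_bounded_lattice_points lattice_polytope_bounded P)
  define Vs where "Vs = {V :: real ^ 'n ^ 'n. \<forall>j. column j V \<in> W}"
  have "Vs \<subseteq> (\<lambda>f. \<chi> i j. f j $ i) ` (UNIV \<rightarrow>\<^sub>E W)"
  proof
    fix V assume "V \<in> Vs"
    then show "V \<in> (\<lambda>f. \<chi> i j. f j $ i) ` (UNIV \<rightarrow>\<^sub>E W)"
      by (intro image_eqI[of _ _ "\<lambda>j. column j V"]) (auto simp: Vs_def vec_eq_iff column_def)
  qed
  then have finVs: "finite Vs" by (rule finite_subset) (intro finite_imageI finite_PiE finW, auto)
  \<comment> \<open>A full-dimensional \<open>P\<close> has spanning lattice points, so some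
    candidate matrix has nonzero determinant and the maximum is positive.\<close>
  have "affine hull P = UNIV" by (rule affine_hull_nonempty_interior[OF P(2)])
  then have "affine hull W = UNIV"
    using lattice_polytope_eq_hull[OF P(1)] affine_hull_convex_hull unfolding W_def by metis
  then have spanW: "span W = UNIV" using affine_hull_subset_span by blast
  obtain B where B: "B \<subseteq> W" "independent B" "W \<subseteq> span B" "card B = dim W"
    by (rule basis_exists)
  have spanB: "span B = UNIV" using spanW B(3) by (metis span_mono span_span top.extremum_uniqueI)
  have "dim W = CARD('n)" using spanW dim_span[of W] by simp
  with B have cardB: "card B = card (UNIV :: 'n set)" by simp
  have "finite B" using B(1) finW finite_subset by blast
  then obtain f :: "'n \<Rightarrow> real ^ 'n" where f: "bij_betw f UNIV B"
    using finite_same_card_bij[OF _ \<open>finite B\<close>] cardB by (metis finite)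
  define V0 where "V0 = (\<chi> i j. f j $ i)"
  have col0: "column j V0 = f j" for j by (simp add: V0_def column_def vec_eq_iff)
  then have "columns V0 = B" using f by (auto simp: columns_def bij_betw_def)
  then have det0: "det V0 \<noteq> 0"
    using matrix_right_invertible_span_columns[of V0] spanB
    by (simp add: span_vec_eq invertible_right_inverse flip: invertible_det_nz)
  have "V0 \<in> Vs" using f B(1) by (auto simp: Vs_def col0 bij_betw_def)
  then obtain V where V: "V \<in> Vs" and max: "\<And>U. U \<in> Vs \<Longrightarrow> \<bar>det U\<bar> \<le> \<bar>det V\<bar>"
    using arg_min_if_finite[OF finVs, of "\<lambda>V. - \<bar>det V\<bar>"] by (metis empty_iff neg_less_iff_less not_le)
  have detV: "det V \<noteq> 0" using max[OF \<open>V0 \<in> Vs\<close>] det0 by auto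
  have "\<bar>a $ k\<bar> \<le> 1" if "V *v a \<in> W" for a k
  proof -
    define U where "U = (\<chi> i j. if j = k then (V *v a) $ i else V $ i $ j)"
    have "column j U = (if j = k then V *v a else column j V)" for j
      by (simp add: U_def column_def vec_eq_iff)
    then have "U \<in> Vs" using V that by (simp add: Vs_def)
    then have "\<bar>det U\<bar> \<le> \<bar>det V\<bar>" by (rule max)
    also have "det U = a $ k * det V" unfolding U_def by (rule cramer_lemma)
    finally show ?thesis using detV by (simp add: abs_mult)
  qed
  with V detV show ?thesis
    unfolding cube_basis_def invertible_det_nz Vs_def W_def by blast
qed

text \<open>The integer lattice expressed in the coordinates of \<open>V\<close>.\<close>

definition pullback_lattice :: "real ^ 'n ^ 'n \<Rightarrow> (real ^ 'n) set" where
  "pullback_lattice V = {a. V *v a \<in> lattice_points}"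

lemma superlattice_pullback:
  assumes "\<And>j. column j V \<in> lattice_points"
  shows "superlattice UNIV (pullback_lattice V)"
proof -
  have "\<forall>i j. V $ i $ j \<in> \<int>" using assms by (auto simp: lattice_points_def column_def)
  then have "V *v a \<in> lattice_points" if "a \<in> lattice_points" for a
    using integer_matrix_iff that by blast
  then show ?thesis
    by (auto simp: superlattice_def pullback_lattice_def matrix_vector_mult_diff_distrib
        lattice_points_def)
qed

text \<open>With \<open>t\<close> the sum of the \<open>\<bar>a j\<bar>\<close>, the vector is
  \<open>t\<close> times a convex combination of the vectors plus or minus \<open>c j\<close>; the
  remaining weight 1 - t goes to the origin.\<close>

lemma symmetric_convex_combination:
  fixes c :: "'i::finite \<Rightarrow> 'a::real_vector"
  assumes "convex P" "0 \<in> P" "\<And>j. c j \<in> P" "\<And>j. - c j \<in> P" "(\<Sum>j\<in>UNIV. \<bar>a j\<bar>) \<le> 1"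
  shows "(\<Sum>j\<in>UNIV. a j *\<^sub>R c j) \<in> P"
proof -
  define t where "t = (\<Sum>j\<in>UNIV. \<bar>a j\<bar>)"
  show ?thesis
  proof (cases "t = 0")
    case True
    then have "a j = 0" for j by (simp add: t_def sum_nonneg_eq_0_iff)
    then show ?thesis using assms by simp
  next
    case False
    then have t: "t > 0" "t \<le> 1" using assms(5) by (auto simp: t_def order_less_le intro!: sum_nonneg)
    define y where "y = (\<lambda>j. if a j \<ge> 0 then c j else - c j)"
    have "(\<Sum>j\<in>UNIV. (\<bar>a j\<bar> / t) *\<^sub>R y j) \<in> P"
      by (rule convex_sum) (use assms t in \<open>auto simp: y_def t_def simp flip: sum_divide_distrib\<close>)
    from convexD_alt[OF assms(1,2) this, of t] t
    have "t *\<^sub>R (\<Sum>j\<in>UNIV. (\<bar>a j\<bar> / t) *\<^sub>R y j) \<in> P" by simp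
    also have "t *\<^sub>R (\<Sum>j\<in>UNIV. (\<bar>a j\<bar> / t) *\<^sub>R y j) = (\<Sum>j\<in>UNIV. a j *\<^sub>R c j)"
      unfolding scaleR_sum_right using t by (intro sum.cong) (auto simp: y_def)
    finally show ?thesis .
  qed
qed

text \<open>By symmetry and convexity \<open>P\<close> contains the cross-polytope spanned by the
  columns of \<open>V\<close>. A pulled-back lattice point in the open standard cross-polytope is
  thus an interior lattice point of \<open>P\<close>, hence 0, and the packing bound
  applies.\<close>

lemma pullback_in_superlattices:
  fixes P :: "(real ^ 'n) set"
  assumes P: "P \<in> sym_lp_no_int" and V: "cube_basis P V"
  shows "pullback_lattice V \<in> superlattices UNIV (fact CARD('n))"
proof -
  have inv: "invertible V" and col: "\<And>j. column j V \<in> P" "\<And>j. column j V \<in> lattice_points"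
    using V by (auto simp: cube_basis_def)
  note inv = matrix_inv_inverse[OF inv]
  have sl: "superlattice UNIV (pullback_lattice V)" by (rule superlattice_pullback[OF col(2)])
  have "lattice_polytope P" and sym: "uminus ` P = P" and int: "interior P \<noteq> {}"
    and noint: "\<And>x. x \<in> interior P \<Longrightarrow> x \<in> lattice_points \<Longrightarrow> x = 0"
    using P by (auto simp: sym_lp_no_int_def)
  then have cvx: "convex P" by (auto simp: lattice_polytope_def)
  have neg: "- x \<in> P" if "x \<in> P" for x using sym that by blast
  obtain p where p: "p \<in> P" using int interior_subset by blast
  have zero: "0 \<in> P" using convexD[OF cvx p neg[OF p], of "1/2" "1/2"] by simp
  have "x = 0" if x: "x \<in> pullback_lattice V" "(\<Sum>j\<in>UNIV. \<bar>x $ j\<bar>) < 1" for x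
  proof -
    \<comment> \<open>The open cross-polytope on the columns of \<open>V\<close>; openness is what
      places \<open>V *v x\<close> in the interior of \<open>P\<close>.\<close>
    define U where "U = {y. (\<Sum>j\<in>UNIV. \<bar>(matrix_inv V *v y) $ j\<bar>) < 1}"
    have "open U" unfolding U_def
      by (intro open_Collect_less continuous_intros matrix_vector_mult_linear_continuous_on)
    moreover have "U \<subseteq> P"
    proof
      fix y assume y: "y \<in> U"
      have "(\<Sum>j\<in>UNIV. (matrix_inv V *v y) $ j *\<^sub>R column j V) \<in> P"
        by (rule symmetric_convex_combination[OF cvx zero]) (use y col neg in \<open>auto simp: U_def\<close>)
      also have "(\<Sum>j\<in>UNIV. (matrix_inv V *v y) $ j *\<^sub>R column j V) = V *v (matrix_inv V *v y)"
        by (simp add: matrix_mult_sum scalar_mult_eq_scaleR)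
      also have "\<dots> = y" by (simp add: matrix_vector_mul_assoc inv)
      finally show "y \<in> P" .
    qed
    moreover have e: "matrix_inv V *v (V *v x) = x" by (simp add: matrix_vector_mul_assoc inv)
    then have "V *v x \<in> U" using x(2) by (simp add: U_def)
    ultimately have "V *v x \<in> interior P" by (auto simp: interior_def)
    with noint x(1) have "V *v x = 0" by (simp add: pullback_lattice_def)
    with e show ?thesis by simp
  qed
  from card_le_fact_of_crosspolytope_packing[OF sl this] sl show ?thesis
    by (simp add: superlattices_def)
qed

text \<open>A point is its fractional part, a cell point of \<open>L\<close>, plus its integer part,
  whose coordinates are -1, 0 or 1; the value 1 occurs only for coordinate 1.\<close>

lemma card_superlattice_cube:
  fixes L :: "(real ^ 'n) set"
  assumes "L \<in> superlattices UNIV M"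
  shows "finite {x\<in>L. \<forall>j. \<bar>x $ j\<bar> \<le> 1} \<and> card {x\<in>L. \<forall>j. \<bar>x $ j\<bar> \<le> 1} \<le> 3 ^ CARD('n) * M"
proof -
  have L: "superlattice UNIV L" and fin: "finite (L \<inter> unit_cell)" and M: "card (L \<inter> unit_cell) \<le> M"
    using assms by (auto simp: superlattices_def)
  define g where "g = (\<lambda>x :: real ^ 'n. (vec_frac x, \<lambda>j. \<lfloor>x $ j\<rfloor>))"
  let ?C = "{x\<in>L. \<forall>j. \<bar>x $ j\<bar> \<le> 1}" and ?D = "(L \<inter> unit_cell) \<times> ((UNIV :: 'n set) \<rightarrow>\<^sub>E {-1..1::int})"
  have inj: "inj_on g ?C"
    by (rule inj_onI) (auto simp: g_def vec_eq_iff frac_def fun_eq_iff)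
  have im: "g ` ?C \<subseteq> ?D"
  proof
    fix p assume "p \<in> g ` ?C"
    then obtain x where x: "x \<in> L" "\<And>j. \<bar>x $ j\<bar> \<le> 1" "p = g x" by auto
    have "\<lfloor>x $ j\<rfloor> \<in> {-1..1}" for j
      using x(2)[of j] by (auto simp: abs_le_iff le_floor_iff floor_le_iff)
    then show "p \<in> ?D" using superlattice_vec_frac[OF L x(1)] by (auto simp: x(3) g_def)
  qed
  have finD: "finite ?D" using fin by (intro finite_cartesian_product finite_PiE) auto
  have "card ?C \<le> card ?D" by (rule card_inj_on_le[OF inj im finD])
  also have "\<dots> = card (L \<inter> unit_cell) * 3 ^ CARD('n)"
    by (simp add: card_cartesian_product card_PiE)
  also have "\<dots> \<le> M * 3 ^ CARD('n)" using M by simp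
  finally show ?thesis using inj_on_finite[OF inj im finD] by (simp add: mult.commute)
qed

text \<open>The change of coordinates \<open>W ** matrix_inv V\<close> preserves the integer lattice
  in both directions because the pullbacks agree. It matches the lattice points of \<open>P\<close>
  with those of \<open>Q\<close>, hence also their hulls.\<close>

lemma GL_Z_equivI:
  fixes P Q :: "(real ^ 'n) set"
  assumes P: "lattice_polytope P" and Q: "lattice_polytope Q" and V: "invertible V" and W: "invertible W"
    and lat: "pullback_lattice V = pullback_lattice W"
    and pts: "{a. V *v a \<in> P \<inter> lattice_points} = {a. W *v a \<in> Q \<inter> lattice_points}"
  shows "GL_Z_equiv P Q"
proof -
  note V = matrix_inv_inverse[OF V] and W = matrix_inv_inverse[OF W]
  define A where "A = W ** matrix_inv V"
  define B where "B = V ** matrix_inv W"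
  have "A ** B = W ** (matrix_inv V ** V) ** matrix_inv W" "B ** A = V ** (matrix_inv W ** W) ** matrix_inv V"
    by (simp_all add: A_def B_def matrix_mul_assoc)
  then have AB: "A ** B = mat 1" "B ** A = mat 1" using V W by simp_all
  have VV: "V *v (matrix_inv V *v x) = x" "W *v (matrix_inv W *v x) = x"
     "matrix_inv V *v (V *v x) = x" for x
    using V W by (simp_all add: matrix_vector_mul_assoc)
  have "A *v x \<in> lattice_points" "B *v x \<in> lattice_points" if "x \<in> lattice_points" for x
  proof -
    have "matrix_inv V *v x \<in> pullback_lattice V" "matrix_inv W *v x \<in> pullback_lattice W"
      using that by (simp_all add: pullback_lattice_def VV)
    then show "A *v x \<in> lattice_points" "B *v x \<in> lattice_points" using lat
      by (auto simp: A_def B_def pullback_lattice_def matrix_vector_mul_assoc[symmetric])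
  qed
  then have "A \<in> GL_Z" unfolding GL_Z_iff using AB integer_matrix_iff by blast
  have "(\<lambda>x. A *v x) ` (P \<inter> lattice_points) = Q \<inter> lattice_points"
  proof (intro equalityI subsetI)
    fix y assume "y \<in> (\<lambda>x. A *v x) ` (P \<inter> lattice_points)"
    then obtain x where x: "x \<in> P \<inter> lattice_points" "y = A *v x" by blast
    then have "matrix_inv V *v x \<in> {a. V *v a \<in> P \<inter> lattice_points}" by (simp add: VV)
    then show "y \<in> Q \<inter> lattice_points" unfolding pts
      by (simp add: x(2) A_def matrix_vector_mul_assoc[symmetric])
  next
    fix y assume "y \<in> Q \<inter> lattice_points"
    then have "matrix_inv W *v y \<in> {a. W *v a \<in> Q \<inter> lattice_points}" by (simp add: VV)
    then have "B *v y \<in> P \<inter> lattice_points" unfolding pts[symmetric]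
      by (simp add: B_def matrix_vector_mul_assoc[symmetric])
    moreover have "y = A *v (B *v y)" by (simp add: matrix_vector_mul_assoc AB)
    ultimately show "y \<in> (\<lambda>x. A *v x) ` (P \<inter> lattice_points)" by blast
  qed
  then have "(\<lambda>x. A *v x) ` P = Q"
    using convex_hull_linear_image[OF matrix_vector_mul_linear, of A "P \<inter> lattice_points"]
    by (simp flip: lattice_polytope_eq_hull[OF P] lattice_polytope_eq_hull[OF Q])
  with \<open>A \<in> GL_Z\<close> show ?thesis unfolding GL_Z_equiv_def by blast
qed

section \<open>Counting orbits by their codes\<close>

theorem theorem11p1:
  shows "finite (sym_lp_orbits :: (real ^ 'n) set set set) \<and>
         card (sym_lp_orbits :: (real ^ 'n) set set set)
           \<le> fact CARD('n) ^ (CARD('n) + 1) * 2 ^ (3 ^ CARD('n) * fact CARD('n))"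
proof -
  define M :: nat where "M = fact CARD('n)"
  define cube where "cube = (\<lambda>L :: (real ^ 'n) set. {x\<in>L. \<forall>j. \<bar>x $ j\<bar> \<le> 1})"
  define T where "T = (SIGMA L:superlattices UNIV M. Pow (cube L))"
  \<comment> \<open>One cube basis is fixed per polytope. Different choices may give different codes
    within an orbit, which is harmless for an upper bound: equal codes must only force equal
    orbits.\<close>
  define V where "V = (\<lambda>P :: (real ^ 'n) set. SOME V. cube_basis P V)"
  define code where "code = (\<lambda>P. (pullback_lattice (V P), {a. V P *v a \<in> P \<inter> lattice_points}))"
  define orb where "orb = (\<lambda>P :: (real ^ 'n) set. {Q \<in> sym_lp_no_int. GL_Z_equiv P Q})"
  have V: "cube_basis P (V P)" if "P \<in> sym_lp_no_int" for P
    unfolding V_def by (rule someI_ex, rule exists_cube_basis) (use that in \<open>auto simp: sym_lp_no_int_def\<close>)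
  have codeT: "code P \<in> T" if "P \<in> sym_lp_no_int" for P
    using pullback_in_superlattices[OF that V[OF that]] V[OF that]
    by (auto simp: T_def code_def M_def cube_def pullback_lattice_def cube_basis_def)
  have orb_eq: "orb P = orb Q" if "P \<in> sym_lp_no_int" "Q \<in> sym_lp_no_int" "code P = code Q" for P Q
  proof -
    have "GL_Z_equiv P Q"
      using that(3) V[OF that(1)] V[OF that(2)] that(1,2)
      by (intro GL_Z_equivI[of P Q "V P" "V Q"]) (auto simp: code_def cube_basis_def sym_lp_no_int_def)
    then show ?thesis using GL_Z_equiv_sym GL_Z_equiv_trans unfolding orb_def by blast
  qed
  \<comment> \<open>Decodes a pair to the orbit of some polytope with that code; the value at pairs
    that are no code is arbitrary, since only a map whose image covers all orbits is wanted.\<close>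
  define h where "h = (\<lambda>c. orb (SOME P. P \<in> sym_lp_no_int \<and> code P = c))"
  have sub: "sym_lp_orbits \<subseteq> h ` T"
  proof
    fix O' assume "O' \<in> (sym_lp_orbits :: (real ^ 'n) set set set)"
    then obtain P where P: "P \<in> sym_lp_no_int" "O' = orb P" by (auto simp: sym_lp_orbits_def orb_def)
    let ?R = "SOME R. R \<in> sym_lp_no_int \<and> code R = code P"
    have "?R \<in> sym_lp_no_int \<and> code ?R = code P"
      by (rule someI[of _ P]) (simp add: P)
    then have "O' = h (code P)" unfolding h_def P(2) using orb_eq P(1) by metis
    with codeT[OF P(1)] show "O' \<in> h ` T" by blast
  qed
  have finS: "finite (superlattices (UNIV :: 'n set) M)"
    and cardS: "card (superlattices (UNIV :: 'n set) M) \<le> M ^ (CARD('n) + 1)"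
    using card_superlattices[of "UNIV :: 'n set" M] by auto
  have cube: "finite (cube L)" "card (cube L) \<le> 3 ^ CARD('n) * M" if "L \<in> superlattices UNIV M" for L
    using card_superlattice_cube[OF that] by (auto simp: cube_def)
  have finT: "finite T" unfolding T_def using finS cube(1) by (intro finite_SigmaI) auto
  have "card T = (\<Sum>L\<in>superlattices UNIV M. 2 ^ card (cube L))"
    unfolding T_def using finS cube(1) by (subst card_SigmaI) (auto simp: card_Pow)
  also have "\<dots> \<le> card (superlattices (UNIV :: 'n set) M) * 2 ^ (3 ^ CARD('n) * M)"
    using sum_bounded_above[of "superlattices (UNIV :: 'n set) M" "\<lambda>L. 2 ^ card (cube L)" "2 ^ (3 ^ CARD('n) * M) :: nat"] cube(2)
    by simp
  also have "\<dots> \<le> M ^ (CARD('n) + 1) * 2 ^ (3 ^ CARD('n) * M)"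
    using cardS by (rule mult_right_mono) simp
  finally have cardT: "card T \<le> M ^ (CARD('n) + 1) * 2 ^ (3 ^ CARD('n) * M)" .
  have "card (sym_lp_orbits :: (real ^ 'n) set set set) \<le> card (h ` T)"
    using sub finT by (intro card_mono) auto
  also have "\<dots> \<le> card T" by (rule card_image_le[OF finT])
  also note cardT
  finally show ?thesis using finite_subset[OF sub] finT by (simp add: M_def)
qed

end
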